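(* Let $n\geq 1$ and consider the Boolean lattice $\mathcal{B}_n=\{0,1\}^n$ with the duality $\nabla$ given by swapping $0$ and $1$ in every coordinate. Then the involution $\phi$ on $\mathrm{Tr}(\mathcal{B}_n)$ given by $\phi(\mathcal{R})=\big(({}^{\square}\mathcal{R})^{\mathrm{op}}\big)^\nabla$ is equal to the involution $\Phi_n$ of Balchin, Bearup, Pech and Roitzheim.
   Context: $\mathcal{B}_n=\{0,1\}^n$ is the product of $n$ copies of $\{0<1\}$ with the coordinatewise order (isomorphic to the subsets of $\{1,\dots,n\}$ under inclusion). A poset $(\mathcal{P},\leq)$ is regarded as a category with a unique morphism (edge) $x\to y$ when $x\leq y$; a relation refining $\leq$ is identified with the corresponding collection of morphisms. A transfer system on a poset $\mathcal{P}$ is a partial order $\mathcal{R}$ on $\mathcal{P}$ that refines $\leq$ (i.e. $x\,\mathcal{R}\,y$ implies $x\leq y$) and such that for all $x,y,z$, if $x\,\mathcal{R}\,y$, $z\leq y$, and $x\wedge z$ exists, then $(x\wedge z)\,\mathcal{R}\,z$. $\mathrm{Tr}(\mathcal{P})$ is the set of transfer systems on $\mathcal{P}$ ordered by inclusion. ${}^{\square}\mathcal{R}$ is the class of morphisms having the left lifting property with respect to all morphisms in $\mathcal{R}$: $a\to b$ is in ${}^{\square}\mathcal{R}$ iff for every $x\to y$ in $\mathcal{R}$ and every commutative square with left side $a\to b$, right side $x\to y$, top $a\to x$, bottom $b\to y$, there is a morphism $b\to x$ making both triangles commute. For a collection $\mathcal{M}$ of morphisms, $(\mathcal{M}^{\mathrm{op}})^\nabla=\{y^\nabla\to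 x^\nabla\mid (x\to y)\in\mathcal{M}\}$. Facets: for $i=1,\dots,n$ the bottom facet $B_i$ (resp. top facet $T_i$) of $\mathcal{B}_n$ is the set of $a\in\{0,1\}^n$ with $a_i=0$ (resp. $a_i=1$); $B_i$ and $T_i$ are opposite facets. For $n\ge 2$ each facet is identified with $\mathcal{B}_{n-1}$ by dropping the $i$th coordinate. Given a transfer system $\mathcal{R}$ on $\mathcal{B}_n$ and a facet $F$, the restriction $\mathcal{R}|_F$ (the edges of $\mathcal{R}$ with both endpoints in $F$) is a transfer system on $F$. The map $\Phi_n\colon\mathrm{Tr}(\mathcal{B}_n)\to\mathrm{Tr}(\mathcal{B}_n)$ is defined inductively. For $n=1$, $\Phi_1$ exchanges the trivial transfer system on $\mathcal{B}_1=\{0<1\}$ (only identity edges) with the full one (all edges). If $\Phi_n$ is defined for some $n\geq 1$ and $\mathcal{R}\in\mathrm{Tr}(\mathcal{B}_{n+1})$, then $\Phi_{n+1}(\mathcal{R})$ is obtained by applying $\Phi_n$ to the restriction of $\mathcal{R}$ to each facet and placing the result in the opposite facet (so that, for each facet $F$ with opposite facet $\tilde F$, $\Phi_{n+1}(\mathcal{R})|_F=\Phi_n(\mathcal{R}|_{\tilde F})$ under the identifications of $F$ and $\tilde F$ with $\mathcal{B}_n$ by dropping the $i$th coordinate), and lastly adding the long diagonal edge $\vec 0\to\vec 1$ (from $(0,\dots,0)$ to $(1,\dots,1)$) if and only if $\mathcal{R}$ contains no nontrivial (non-identity) edge with target $\vec 1$. It is a known result of Balchin, Bearup, Pech and Roitzheim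 that $\Phi_n$ is well defined and is an order-reversing involution of $\mathrm{Tr}(\mathcal{B}_n)$. *)

theory Defs
  imports Main
begin

text \<open>A poset is a carrier \<open>P\<close> with an order relation \<open>L\<close>, a subset of \<open>P \<times> P\<close>. Viewed as a category it has
  at most one morphism \<open>x \<rightarrow> y\<close>, encoded as the pair \<open>(x, y) \<in> L\<close>; collections of morphisms are
  subsets of \<open>L\<close>.\<close>

definition is_meet :: "'a set \<Rightarrow> 'a rel \<Rightarrow> 'a \<Rightarrow> 'a \<Rightarrow> 'a \<Rightarrow> bool" where
  "is_meet P L x z m \<longleftrightarrow> m \<in> P \<and> (m, x) \<in> L \<and> (m, z) \<in> L \<and>
     (\<forall>w\<in>P. (w, x) \<in> L \<and> (w, z) \<in> L \<longrightarrow> (w, m) \<in> L)"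

definition transfer_system :: "'a set \<Rightarrow> 'a rel \<Rightarrow> 'a rel \<Rightarrow> bool" where
  "transfer_system P L R \<longleftrightarrow> partial_order_on P R \<and> R \<subseteq> L \<and>
     (\<forall>x y z m. (x, y) \<in> R \<and> (z, y) \<in> L \<and> is_meet P L x z m \<longrightarrow> (m, z) \<in> R)"

definition Tr :: "'a set \<Rightarrow> 'a rel \<Rightarrow> 'a rel set" where
  "Tr P L = {R. transfer_system P L R}"

text \<open>The left lifting property in the category of the poset \<open>L\<close>. Squares and triangles commute
  automatically, as there is at most one morphism between two objects.\<close>

definition llp :: "'a rel \<Rightarrow> 'a rel \<Rightarrow> 'a rel" where
  "llp L R = {(a, b). (a, b) \<in> L \<and>
     (\<forall>x y. (x, y) \<in> R \<and> (a, x) \<in> L \<and> (b, y) \<in> L \<longrightarrow> (b, x) \<in> L)}"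

definition op_dual :: "('a \<Rightarrow> 'a) \<Rightarrow> 'a rel \<Rightarrow> 'a rel" where
  "op_dual d M = {(d y, d x) | x y. (x, y) \<in> M}"

text \<open>The elements of \<open>{0,1}\<^sup>n\<close> are the Boolean lists of length \<open>n\<close>, with \<open>False < True\<close> for \<open>0 < 1\<close>.
  Coordinates are numbered \<open>0, \<dots>, n - 1\<close>.\<close>

definition cube :: "nat \<Rightarrow> bool list set" where
  "cube n = {a. length a = n}"

definition cube_le :: "nat \<Rightarrow> bool list rel" where
  "cube_le n = {(a, b). a \<in> cube n \<and> b \<in> cube n \<and> list_all2 (\<le>) a b}"

definition nabla :: "bool list \<Rightarrow> bool list" where
  "nabla a = map Not a"

definition phi :: "nat \<Rightarrow> bool list rel \<Rightarrow> bool list rel" where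
  "phi n R = op_dual nabla (llp (cube_le n) R)"

text \<open>\<open>facet n i False\<close> is the bottom facet and \<open>facet n i True\<close> the top facet in direction \<open>i\<close>.\<close>

definition facet :: "nat \<Rightarrow> nat \<Rightarrow> bool \<Rightarrow> bool list set" where
  "facet n i b = {a \<in> cube n. a ! i = b}"

definition drop_coord :: "nat \<Rightarrow> 'a list \<Rightarrow> 'a list" where
  "drop_coord i a = take i a @ drop (Suc i) a"

text \<open>Restriction of a relation on the cube of dimension \<open>n\<close> to a facet, and placement of a relation on
  the cube of dimension \<open>n - 1\<close> in a facet, both along the identification by \<^const>\<open>drop_coord\<close>.\<close>

definition restrict_facet :: "nat \<Rightarrow> nat \<Rightarrow> bool \<Rightarrow> bool list rel \<Rightarrow> bool list rel" where
  "restrict_facet n i b R =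
     {(drop_coord i x, drop_coord i y) | x y. (x, y) \<in> R \<and> x \<in> facet n i b \<and> y \<in> facet n i b}"

definition place_facet :: "nat \<Rightarrow> nat \<Rightarrow> bool \<Rightarrow> bool list rel \<Rightarrow> bool list rel" where
  "place_facet n i b S =
     {(x, y). x \<in> facet n i b \<and> y \<in> facet n i b \<and> (drop_coord i x, drop_coord i y) \<in> S}"

definition diagonal :: "nat \<Rightarrow> bool list rel \<Rightarrow> bool list rel" where
  "diagonal n R =
     (if \<exists>x. (x, replicate n True) \<in> R \<and> x \<noteq> replicate n True then {}
      else {(replicate n False, replicate n True)})"

text \<open>The involution of Balchin, Bearup, Pech and Roitzheim; dimension \<open>0\<close> is left unspecified.\<close>

fun Phi :: "nat \<Rightarrow> bool list rel \<Rightarrow> bool list rel" where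
  "Phi (Suc 0) R = (if R = Id_on (cube 1) then cube_le 1 else Id_on (cube 1))"
| "Phi (Suc (Suc n)) R =
     (\<Union>i<n + 2. \<Union>b. place_facet (n + 2) i b (Phi (Suc n) (restrict_facet (n + 2) i (\<not> b) R)))
     \<union> diagonal (n + 2) R"

text \<open>The map \<^const>\<open>phi\<close> maps transfer systems to transfer systems and is an involution on them.\<close>

lemma cube_le_iff:
  "(a, b) \<in> cube_le n \<longleftrightarrow> length a = n \<and> length b = n \<and> (\<forall>i<n. a ! i \<longrightarrow> b ! i)"
  by (auto simp: cube_le_def cube_def list_all2_conv_all_nth)

lemma cube_le_refl: "length a = n \<Longrightarrow> (a, a) \<in> cube_le n"
  by (simp add: cube_le_iff)

lemma cube_le_trans: "(a, b) \<in> cube_le n \<Longrightarrow> (b, c) \<in> cube_le n \<Longrightarrow> (a, c) \<in> cube_le n"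
  by (simp add: cube_le_iff)

lemma cube_le_antisym: "(a, b) \<in> cube_le n \<Longrightarrow> (b, a) \<in> cube_le n \<Longrightarrow> a = b"
  by (auto simp: cube_le_iff intro: nth_equalityI)

lemma nabla_nabla [simp]: "nabla (nabla a) = a"
  by (simp add: nabla_def o_def)

lemma length_nabla [simp]: "length (nabla a) = length a"
  by (simp add: nabla_def)

lemma nabla_le: "(nabla b, nabla a) \<in> cube_le n \<longleftrightarrow> (a, b) \<in> cube_le n"
  by (auto simp: cube_le_iff nabla_def)

lemma nabla_le': "(nabla b, a) \<in> cube_le n \<longleftrightarrow> (nabla a, b) \<in> cube_le n"
  by (metis nabla_le nabla_nabla)

lemma phi_iff: "(a, b) \<in> phi n R \<longleftrightarrow> (nabla b, nabla a) \<in> llp (cube_le n) R"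
  unfolding phi_def op_dual_def by (auto, metis nabla_nabla)

lemma is_meet_cube:
  assumes "length x = n" "length z = n"
  shows "is_meet (cube n) (cube_le n) x z (map2 (\<and>) x z)"
  using assms by (auto simp: is_meet_def cube_le_iff cube_def)

lemma phi_transfer_system:
  assumes "R \<in> Tr (cube n) (cube_le n)"
  shows "phi n R \<in> Tr (cube n) (cube_le n)"
proof -
  let ?L = "cube_le n"
  have sub: "phi n R \<subseteq> ?L"
    by (auto simp: phi_iff llp_def nabla_le)
  have "refl_on (cube n) (phi n R)"
    by (auto simp: refl_on_def phi_iff llp_def cube_def cube_le_refl)
  moreover have "trans (phi n R)"
  proof (rule transI)
    fix x y z
    assume xy: "(x, y) \<in> phi n R" and yz: "(y, z) \<in> phi n R"
    have "(nabla x, p) \<in> ?L" if "(p, q) \<in> R" "(nabla z, p) \<in> ?L" "(nabla x, q) \<in> ?L" for p q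
    proof -
      have "(nabla y, q) \<in> ?L"
        using that xy by (auto simp: phi_iff llp_def intro: cube_le_trans)
      then have "(nabla y, p) \<in> ?L"
        using that yz by (auto simp: phi_iff llp_def)
      then show ?thesis
        using that xy by (auto simp: phi_iff llp_def)
    qed
    moreover have "(nabla z, nabla x) \<in> ?L"
      using xy yz sub cube_le_trans nabla_le by blast
    ultimately show "(x, z) \<in> phi n R"
      by (auto simp: phi_iff llp_def)
  qed
  moreover have "antisym (phi n R)"
    using sub cube_le_antisym unfolding antisym_def by blast
  moreover have "phi n R \<subseteq> cube n \<times> cube n"
    using sub by (auto simp: cube_le_def)
  moreover have "(m, z) \<in> phi n R"
    if xy: "(x, y) \<in> phi n R" and zy: "(z, y) \<in> ?L" and m: "is_meet (cube n) ?L x z m" for x y z m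
  proof -
    have "(nabla m, p) \<in> ?L" if pq: "(p, q) \<in> R" "(nabla z, p) \<in> ?L" "(nabla m, q) \<in> ?L" for p q
    proof -
      have "(nabla y, p) \<in> ?L" "(nabla x, q) \<in> ?L"
        using m zy pq cube_le_trans nabla_le unfolding is_meet_def by metis+
      then have "(nabla x, p) \<in> ?L"
        using xy pq(1) by (auto simp: phi_iff llp_def)
      then have "(nabla p, x) \<in> ?L" "(nabla p, z) \<in> ?L"
        using pq(2) nabla_le' by blast+
      moreover from this have "nabla p \<in> cube n"
        by (simp add: cube_le_def)
      ultimately have "(nabla p, m) \<in> ?L"
        using m unfolding is_meet_def by blast
      then show ?thesis
        using nabla_le' by blast
    qed
    then show ?thesis
      using m by (auto simp: phi_iff llp_def nabla_le is_meet_def)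
  qed
  ultimately show ?thesis
    using sub by (auto simp: Tr_def transfer_system_def partial_order_on_def preorder_on_def)
qed

lemma phi_involution:
  assumes "R \<in> Tr (cube n) (cube_le n)"
  shows "phi n (phi n R) = R"
proof -
  let ?L = "cube_le n"
  have po: "partial_order_on (cube n) R" and sub: "R \<subseteq> ?L"
    and tr: "\<And>x y z m. (x, y) \<in> R \<Longrightarrow> (z, y) \<in> ?L \<Longrightarrow> is_meet (cube n) ?L x z m \<Longrightarrow> (m, z) \<in> R"
    using assms by (auto simp: Tr_def transfer_system_def)
  have rlp: "(x, y) \<in> phi n (phi n R) \<longleftrightarrow> (x, y) \<in> ?L \<and>
      (\<forall>a b. (a, b) \<in> llp ?L R \<and> (a, x) \<in> ?L \<and> (b, y) \<in> ?L \<longrightarrow> (b, x) \<in> ?L)" for x y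
  proof -
    have "(x, y) \<in> phi n (phi n R) \<longleftrightarrow> (x, y) \<in> ?L \<and>
        (\<forall>p q. (nabla q, nabla p) \<in> llp ?L R \<and> (nabla q, x) \<in> ?L \<and> (nabla p, y) \<in> ?L
          \<longrightarrow> (nabla p, x) \<in> ?L)"
      unfolding phi_iff [of x y n "phi n R"] llp_def [of _ "phi n R"]
      by (simp add: nabla_le nabla_le' [of x] nabla_le' [of y] phi_iff conj_commute conj_left_commute)
    then show ?thesis
      by (metis nabla_nabla)
  qed
  have "(x, y) \<in> R" if xy: "(x, y) \<in> phi n (phi n R)" for x y
  proof -
    let ?W = "{w. (x, w) \<in> ?L \<and> (w, y) \<in> R}"
    have L: "(x, y) \<in> ?L" using xy rlp by blast
    have "(y, y) \<in> R"
      using po L by (auto simp: partial_order_on_def preorder_on_def refl_on_def cube_le_def)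
    then have "y \<in> ?W" using L by simp
    then obtain z where z: "z \<in> ?W"
      and min: "\<And>w. w \<in> ?W \<Longrightarrow> card {i. i < n \<and> z ! i} \<le> card {i. i < n \<and> w ! i}"
      using ex_has_least_nat [of "\<lambda>w. w \<in> ?W" y "\<lambda>w. card {i. i < n \<and> w ! i}"] by blast
    have "(z, p) \<in> ?L" if pq: "(p, q) \<in> R" "(x, p) \<in> ?L" "(z, q) \<in> ?L" for p q
    proof -
      define m where "m = map2 (\<and>) p z"
      have len: "length p = n" "length z = n"
        using pq(2,3) by (auto simp: cube_le_iff)
      have m: "is_meet (cube n) ?L p z m"
        unfolding m_def using len by (rule is_meet_cube)
      have "(m, y) \<in> R"
        using tr [OF pq(1,3) m] z po
        by (auto simp: partial_order_on_def preorder_on_def dest: transD)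
      moreover have "(x, m) \<in> ?L"
        using m pq(2) z by (auto simp: is_meet_def cube_le_def)
      ultimately have "m \<in> ?W" by simp
      have "{i. i < n \<and> m ! i} \<subseteq> {i. i < n \<and> z ! i}"
        using len by (auto simp: m_def)
      then have "{i. i < n \<and> m ! i} = {i. i < n \<and> z ! i}"
        using min [OF \<open>m \<in> ?W\<close>] by (intro card_seteq) simp_all
      then have "m ! i" if "i < n" "z ! i" for i
        using that by blast
      then have "p ! i" if "i < n" "z ! i" for i
        using that len by (simp add: m_def)
      then show ?thesis
        using len by (simp add: cube_le_iff)
    qed
    then have "(x, z) \<in> llp ?L R"
      using z unfolding llp_def by blast
    moreover have "(x, x) \<in> ?L" "(z, y) \<in> ?L"
      using L z sub by (auto simp: cube_le_iff)
    ultimately have "(z, x) \<in> ?L"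
      using xy rlp by blast
    then show ?thesis
      using z cube_le_antisym by blast
  qed
  moreover have "(x, y) \<in> phi n (phi n R)" if "(x, y) \<in> R" for x y
    using that sub unfolding rlp llp_def by blast
  ultimately show ?thesis by auto
qed

end

theory Submission
  imports Defs
begin

text \<open>By induction on the dimension. For an edge inside a facet \<open>F\<close>, lifting against \<open>R\<close> is equivalent
  to lifting against \<open>R|\<^sub>F\<close>: if \<open>F\<close> is a top facet, every \<open>x \<rightarrow> y\<close> receiving a square from an edge of \<open>F\<close>
  lies in \<open>F\<close>, and if \<open>F\<close> is a bottom facet, the square factors through the pullback of \<open>x \<rightarrow> y\<close> along
  the meet of \<open>y\<close> with the top element of \<open>F\<close>, which lies in \<open>R|\<^sub>F\<close>. Duality carries \<open>F\<close> to the opposite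
  facet. The only edge of the cube inside no facet is the long diagonal, which lifts against \<open>R\<close> exactly
  if no nontrivial edge of \<open>R\<close> ends in the top element.\<close>

section \<open>Transfer systems on the cube, with explicit meets\<close>

lemma is_meet_cube_iff:
  assumes "length x = n" "length z = n"
  shows "is_meet (cube n) (cube_le n) x z m \<longleftrightarrow> m = map2 (\<and>) x z"
  using is_meet_cube[OF assms] unfolding is_meet_def by (metis cube_le_antisym)

lemma cube_le_lengthD:
  assumes "(x, y) \<in> cube_le n"
  shows "length x = n" "length y = n"
  using assms by (auto simp: cube_le_iff)

text \<open>Antisymmetry and the carrier condition are inherited from \<open>cube_le n\<close>, and
  meets are unique, so the restriction axiom need only be tested on the coordinatewise
  conjunction.\<close>

lemma Tr_cube_iff:
  "R \<in> Tr (cube n) (cube_le n) \<longleftrightarrow>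
     R \<subseteq> cube_le n \<and> (\<forall>x. length x = n \<longrightarrow> (x, x) \<in> R) \<and> trans R \<and>
     (\<forall>x y z. (x, y) \<in> R \<and> (z, y) \<in> cube_le n \<longrightarrow> (map2 (\<and>) x z, z) \<in> R)"
  (is "_ \<longleftrightarrow> ?sub \<and> ?refl \<and> trans R \<and> ?pull")
proof (cases ?sub)
  case True
  then have antisym: "antisym R"
    unfolding antisym_def using cube_le_antisym by blast
  have carrier: "R \<subseteq> cube n \<times> cube n"
    using True by (auto simp: cube_le_def)
  have refl_on: "refl_on (cube n) R \<longleftrightarrow> ?refl"
    by (auto simp: refl_on_def cube_def)
  have pull: "(\<forall>x y z m. (x, y) \<in> R \<and> (z, y) \<in> cube_le n \<and>
      is_meet (cube n) (cube_le n) x z m \<longrightarrow> (m, z) \<in> R) \<longleftrightarrow> ?pull"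
  proof -
    have "(x, y) \<in> R \<and> (z, y) \<in> cube_le n \<and> is_meet (cube n) (cube_le n) x z m \<longleftrightarrow>
        (x, y) \<in> R \<and> (z, y) \<in> cube_le n \<and> m = map2 (\<and>) x z" for x y z m
      using True by (intro conj_cong refl is_meet_cube_iff) (auto dest: cube_le_lengthD)
    then show ?thesis
      by simp
  qed
  show ?thesis
    by (simp only: Tr_def mem_Collect_eq transfer_system_def partial_order_on_def preorder_on_def
        True antisym carrier refl_on pull simp_thms conj_ac)
qed (auto simp: Tr_def transfer_system_def)

section \<open>Facets parametrized by \<open>insert_coord\<close>, the inverse of
  \<open>drop_coord\<close>\<close>

definition insert_coord :: "nat \<Rightarrow> 'a \<Rightarrow> 'a list \<Rightarrow> 'a list" where
  "insert_coord i b u = take i u @ b # drop i u"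

lemma length_insert_coord [simp]: "length (insert_coord i b u) = Suc (length u)"
  by (simp add: insert_coord_def)

lemma insert_coord_nth [simp]: "i \<le> length u \<Longrightarrow> insert_coord i b u ! i = b"
  by (simp add: insert_coord_def nth_append)

lemma drop_insert_coord [simp]: "i \<le> length u \<Longrightarrow> drop_coord i (insert_coord i b u) = u"
  by (simp add: insert_coord_def drop_coord_def)

lemma length_drop_coord: "i < length x \<Longrightarrow> length (drop_coord i x) = length x - 1"
  by (simp add: drop_coord_def)

lemma insert_drop_coord: "i < length x \<Longrightarrow> insert_coord i (x ! i) (drop_coord i x) = x"
  by (simp add: insert_coord_def drop_coord_def min_def id_take_nth_drop[symmetric])

lemma insert_coord_in_facet:
  "length u = n \<Longrightarrow> i \<le> n \<Longrightarrow> insert_coord i b u \<in> facet (Suc n) i b"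
  by (simp add: facet_def cube_def)

lemma facetE:
  assumes "x \<in> facet (Suc n) i b" "i \<le> n"
  obtains u where "length u = n" "x = insert_coord i b u"
  using assms that[of "drop_coord i x"] insert_drop_coord[of i x] length_drop_coord[of i x]
  by (auto simp: facet_def cube_def)

lemma insert_coord_le:
  assumes "length u = n" "length v = n"
  shows "(insert_coord i b u, insert_coord i b v) \<in> cube_le (Suc n) \<longleftrightarrow> (u, v) \<in> cube_le n"
proof -
  \<comment> \<open>Splitting both lists at \<open>i\<close>, the inserted entry only adds the
    comparison of \<open>b\<close> with itself.\<close>
  have "list_all2 (\<le>) u v \<longleftrightarrow> list_all2 (\<le>) (take i u @ drop i u) (take i v @ drop i v)"
    by simp
  also have "\<dots> \<longleftrightarrow> list_all2 (\<le>) (insert_coord i b u) (insert_coord i b v)"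
    unfolding insert_coord_def using assms by (subst (1 2) list_all2_append) auto
  finally show ?thesis
    using assms by (simp add: cube_le_def cube_def)
qed

lemma nabla_insert_coord: "nabla (insert_coord i b u) = insert_coord i (\<not> b) (nabla u)"
  by (simp add: insert_coord_def nabla_def take_map drop_map)

lemma map2_insert_coord:
  assumes "length u = length v"
  shows "map2 f (insert_coord i a u) (insert_coord i b v) = insert_coord i (f a b) (map2 f u v)"
  using assms by (simp add: insert_coord_def take_map drop_map take_zip drop_zip)

text \<open>\<open>drop_coord i\<close> is injective on the facet, so the existential in
  \<open>restrict_facet\<close> has a single candidate pair, which \<open>insert_coord\<close>
  names.\<close>

lemma restrict_facet_iff:
  assumes "R \<subseteq> cube_le (Suc n)" "i \<le> n"
  shows "(u, v) \<in> restrict_facet (Suc n) i b R \<longleftrightarrow>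
    length u = n \<and> length v = n \<and> (insert_coord i b u, insert_coord i b v) \<in> R"
proof
  assume "(u, v) \<in> restrict_facet (Suc n) i b R"
  then show "length u = n \<and> length v = n \<and> (insert_coord i b u, insert_coord i b v) \<in> R"
    using assms(2) unfolding restrict_facet_def by (auto elim!: facetE)
next
  assume "length u = n \<and> length v = n \<and> (insert_coord i b u, insert_coord i b v) \<in> R"
  then show "(u, v) \<in> restrict_facet (Suc n) i b R"
    unfolding restrict_facet_def using assms(2)
    by (intro CollectI exI[of _ "insert_coord i b u"] exI[of _ "insert_coord i b v"])
      (simp add: insert_coord_in_facet)
qed

lemma restrict_facet_Tr:
  assumes "R \<in> Tr (cube (Suc n)) (cube_le (Suc n))" "i \<le> n"
  shows "restrict_facet (Suc n) i b R \<in> Tr (cube n) (cube_le n)"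
proof -
  let ?S = "restrict_facet (Suc n) i b R"
  have sub: "R \<subseteq> cube_le (Suc n)" and "trans R"
    and refl: "\<And>x. length x = Suc n \<Longrightarrow> (x, x) \<in> R"
    and pull: "\<And>x y z. (x, y) \<in> R \<Longrightarrow> (z, y) \<in> cube_le (Suc n) \<Longrightarrow> (map2 (\<and>) x z, z) \<in> R"
    using assms(1) by (auto simp: Tr_cube_iff)
  note S = restrict_facet_iff[OF sub assms(2)]
  have "?S \<subseteq> cube_le n"
  proof (rule subrelI)
    fix u v assume "(u, v) \<in> ?S"
    then show "(u, v) \<in> cube_le n"
      using sub insert_coord_le[of u n v i b] by (auto simp: S)
  qed
  moreover have "(u, u) \<in> ?S" if "length u = n" for u
    using that by (simp add: S refl)
  moreover have "trans ?S"
    using \<open>trans R\<close> unfolding trans_def S by blast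
  moreover have "(map2 (\<and>) u w, w) \<in> ?S"
    if uv: "(u, v) \<in> ?S" and wv: "(w, v) \<in> cube_le n" for u v w
  proof -
    have len: "length u = n" "length v = n" "length w = n"
      using uv wv by (simp_all add: S cube_le_lengthD)
    then have "(insert_coord i b w, insert_coord i b v) \<in> cube_le (Suc n)"
      using wv by (simp add: insert_coord_le)
    \<comment> \<open>The facet is closed under meets, because \<open>b \<and> b\<close> is
      \<open>b\<close>.\<close>
    then have "(map2 (\<and>) (insert_coord i b u) (insert_coord i b w), insert_coord i b w) \<in> R"
      using uv by (intro pull) (simp_all add: S)
    then show ?thesis
      using len by (simp add: S map2_insert_coord)
  qed
  ultimately show ?thesis
    unfolding Tr_cube_iff by blast
qed

lemma llp_insert_coord:
  assumes "R \<in> Tr (cube (Suc n)) (cube_le (Suc n))" "i \<le> n" "length u = n" "length v = n"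
  shows "(insert_coord i b u, insert_coord i b v) \<in> llp (cube_le (Suc n)) R \<longleftrightarrow>
    (u, v) \<in> llp (cube_le n) (restrict_facet (Suc n) i b R)"
    (is "(?a, ?c) \<in> llp ?L R \<longleftrightarrow> _ \<in> llp _ ?S")
proof -
  have sub: "R \<subseteq> ?L"
    and pull: "\<And>x y z. (x, y) \<in> R \<Longrightarrow> (z, y) \<in> ?L \<Longrightarrow> (map2 (\<and>) x z, z) \<in> R"
    using assms(1) by (auto simp: Tr_cube_iff)
  note S = restrict_facet_iff[OF sub assms(2)]
  show ?thesis
  proof
    \<comment> \<open>A square into the restriction is a square into \<open>R\<close>, so lifts are
      inherited.\<close>
    assume ac: "(?a, ?c) \<in> llp ?L R"
    have "(v, p) \<in> cube_le n" if "(p, q) \<in> ?S" "(u, p) \<in> cube_le n" "(v, q) \<in> cube_le n" for p q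
    proof -
      have "length p = n" "length q = n" "(insert_coord i b p, insert_coord i b q) \<in> R"
        using that(1) by (auto simp: S)
      moreover from this have "(?c, insert_coord i b p) \<in> ?L"
        using ac that(2,3) assms(3,4) unfolding llp_def by (blast intro: insert_coord_le[THEN iffD2])
      ultimately show ?thesis
        using assms(4) by (simp add: insert_coord_le)
    qed
    moreover have "(u, v) \<in> cube_le n"
      using ac assms(3,4) by (simp add: llp_def insert_coord_le)
    ultimately show "(u, v) \<in> llp (cube_le n) ?S"
      unfolding llp_def by blast
  next
    assume uv: "(u, v) \<in> llp (cube_le n) ?S"
    \<comment> \<open>Squares whose right side already lies in the facet; both cases below reduce to
      these.\<close>
    have in_facet: "(?c, x) \<in> ?L"
      if xy: "(x, y) \<in> R" "(?a, x) \<in> ?L" "(?c, y) \<in> ?L" "x ! i = b" "y ! i = b" for x y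
    proof -
      have "x \<in> facet (Suc n) i b" "y \<in> facet (Suc n) i b"
        using that by (auto simp: facet_def cube_def dest: cube_le_lengthD)
      then obtain p q where "length p = n" "length q = n"
        "x = insert_coord i b p" "y = insert_coord i b q"
        using assms(2) by (metis facetE)
      then show ?thesis
        using uv xy assms(3,4) by (auto simp: llp_def S insert_coord_le)
    qed
    have "(?c, x) \<in> ?L" if xy: "(x, y) \<in> R" "(?a, x) \<in> ?L" "(?c, y) \<in> ?L" for x y
    proof (cases b)
      case True
      \<comment> \<open>Coordinate \<open>i\<close> is 1 in \<open>?a\<close> and \<open>?c\<close>,
        and \<open>x\<close> and \<open>y\<close> lie above them.\<close>
      then have "x ! i" "y ! i"
        using xy(2,3) assms(2-4) insert_coord_nth[of i u b] insert_coord_nth[of i v b]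
        by (auto simp: cube_le_iff less_Suc_eq_le)
      with True show ?thesis
        using in_facet[OF xy] by simp
    next
      case False
      \<comment> \<open>\<open>z\<close> is the meet of \<open>y\<close> with the top element of the
        bottom facet, and \<open>w \<rightarrow> z\<close> is the pullback of
        \<open>x \<rightarrow> y\<close> along \<open>z \<le> y\<close>. A lift
        \<open>?c \<le> w\<close> composes with \<open>w \<le> x\<close>.\<close>
      define z where "z = y[i := False]"
      define w where "w = map2 (\<and>) x z"
      have len: "length x = Suc n" "length y = Suc n" "length z = Suc n"
        using xy(2,3) by (auto simp: cube_le_iff z_def)
      have zy: "(z, y) \<in> ?L" and wx: "(w, x) \<in> ?L"
        using len assms(2) by (auto simp: z_def w_def cube_le_iff nth_list_update split: if_splits)
      have cz: "(?c, z) \<in> ?L"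
        using xy(3) False assms(4) len insert_coord_nth[of i v b] assms(2)
        by (auto simp: z_def cube_le_iff nth_list_update)
      \<comment> \<open>Needed for \<open>?a \<le> w\<close>: besides \<open>?a \<le> x\<close> this
        takes \<open>?a \<le> ?c \<le> z\<close>.\<close>
      have "(?a, ?c) \<in> ?L"
        using uv assms(3,4) by (simp add: llp_def insert_coord_le)
      then have "(?a, w) \<in> ?L"
        using xy(2) cz len by (auto simp: w_def cube_le_iff)
      moreover have "(w, z) \<in> R"
        unfolding w_def using xy(1) zy by (rule pull)
      moreover have "w ! i = b" "z ! i = b"
        using False len assms(2) by (auto simp: w_def z_def)
      ultimately show ?thesis
        using in_facet cz wx cube_le_trans by blast
    qed
    moreover have "(?a, ?c) \<in> ?L"
      using uv assms(3,4) by (simp add: llp_def insert_coord_le)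
    ultimately show "(?a, ?c) \<in> llp ?L R"
      unfolding llp_def by blast
  qed
qed

text \<open>\<open>nabla\<close> also negates the inserted coordinate, hence the
  \<open>\<not> b\<close>, in agreement with the facet clause of \<open>Phi\<close>.\<close>

lemma phi_facet:
  assumes "R \<in> Tr (cube (Suc n)) (cube_le (Suc n))" "i \<le> n"
    "x \<in> facet (Suc n) i b" "y \<in> facet (Suc n) i b"
  shows "(x, y) \<in> phi (Suc n) R \<longleftrightarrow>
    (drop_coord i x, drop_coord i y) \<in> phi n (restrict_facet (Suc n) i (\<not> b) R)"
proof -
  obtain u v where "length u = n" "length v = n"
    "x = insert_coord i b u" "y = insert_coord i b v"
    using assms(2-4) by (metis facetE)
  then show ?thesis
    using assms(1,2) by (simp add: phi_iff nabla_insert_coord llp_insert_coord)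
qed

section \<open>The long diagonal and the recursion for \<open>phi\<close>\<close>

lemma phi_subset_cube_le: "phi n R \<subseteq> cube_le n"
  by (auto simp: phi_iff llp_def nabla_le)

lemma cube_le_replicate_True: "(replicate n True, y) \<in> cube_le n \<longleftrightarrow> y = replicate n True"
  by (auto simp: cube_le_iff intro: nth_equalityI)

lemma nabla_replicate [simp]: "nabla (replicate n b) = replicate n (\<not> b)"
  by (simp add: nabla_def)

text \<open>The diagonal is its own dual. In a square from it to \<open>x \<rightarrow> y\<close>
  the top edge always exists, the bottom edge forces \<open>y\<close> to be the top element, and a
  lift forces \<open>x\<close> to be it too.\<close>

lemma phi_diagonal:
  assumes "R \<subseteq> cube_le n"
  shows "(replicate n False, replicate n True) \<in> phi n R \<longleftrightarrow>
    \<not> (\<exists>x. (x, replicate n True) \<in> R \<and> x \<noteq> replicate n True)"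
proof -
  have "(replicate n False, x) \<in> cube_le n" if "length x = n" for x
    using that by (simp add: cube_le_iff)
  then show ?thesis
    using assms by (auto simp: phi_iff llp_def cube_le_replicate_True dest: cube_le_lengthD)
qed

text \<open>A coordinate on which \<open>x\<close> and \<open>y\<close> agree gives a facet. If
  there is none, \<open>x \<le> y\<close> forces 0 in \<open>x\<close> and 1 in \<open>y\<close>
  everywhere.\<close>

lemma cube_le_cases:
  assumes "(x, y) \<in> cube_le n"
  obtains (facet) i b where "i < n" "x \<in> facet n i b" "y \<in> facet n i b"
    | (diagonal) "x = replicate n False" "y = replicate n True"
proof (cases "\<exists>i<n. x ! i = y ! i")
  case True
  then show ?thesis
    using assms facet by (force simp: facet_def cube_le_iff cube_def)
next
  case False
  then have "x = replicate n False" "y = replicate n True"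
    using assms by (auto simp: cube_le_iff intro!: nth_equalityI)
  then show ?thesis
    by (rule diagonal)
qed

lemma phi_Suc_Suc:
  assumes "R \<in> Tr (cube (Suc (Suc n))) (cube_le (Suc (Suc n)))"
  shows "phi (Suc (Suc n)) R =
    (\<Union>i<n + 2. \<Union>b. place_facet (n + 2) i b (phi (Suc n) (restrict_facet (n + 2) i (\<not> b) R)))
    \<union> diagonal (n + 2) R" (is "?l = ?r")
proof -
  have sub: "R \<subseteq> cube_le (Suc (Suc n))"
    using assms by (simp add: Tr_cube_iff)
  have "(x, y) \<in> ?r" if xy: "(x, y) \<in> ?l" for x y
  proof -
    have "(x, y) \<in> cube_le (Suc (Suc n))"
      using xy phi_subset_cube_le by blast
    then show ?thesis
    proof (cases rule: cube_le_cases)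
      case (facet i b)
      then show ?thesis
        using xy phi_facet[OF assms, of i x b y]
        by (auto simp: place_facet_def intro!: bexI[of _ i])
    next
      case diagonal
      then show ?thesis
        using xy phi_diagonal[OF sub] unfolding diagonal_def by auto
    qed
  qed
  moreover have "place_facet (n + 2) i b (phi (Suc n) (restrict_facet (n + 2) i (\<not> b) R)) \<subseteq> ?l"
    if "i < n + 2" for i b
    using that phi_facet[OF assms, of i _ b] by (auto simp: place_facet_def)
  moreover have "diagonal (n + 2) R \<subseteq> ?l"
    using phi_diagonal[OF sub] by (simp add: diagonal_def)
  ultimately show ?thesis
    by (intro equalityI subrelI) blast+
qed

section \<open>Dimension one\<close>

lemma cube_1: "cube (Suc 0) = {[False], [True]}"
  by (auto simp: cube_def length_Suc_conv)

lemma cube_le_1: "cube_le (Suc 0) = {([False], [False]), ([False], [True]), ([True], [True])}"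
  by (auto simp: cube_le_def cube_1)

lemma Id_on_Tr: "Id_on (cube n) \<in> Tr (cube n) (cube_le n)"
proof -
  have "map2 (\<and>) x z = z" if "(z, x) \<in> cube_le n" for x z
    using that by (auto simp: cube_le_iff intro!: nth_equalityI)
  then show ?thesis
    unfolding Tr_cube_iff
    by (auto simp: cube_def cube_le_refl trans_def dest: cube_le_lengthD)
qed

text \<open>In a square into an identity edge the bottom edge is already the lift.\<close>

lemma phi_Id_on: "phi n (Id_on (cube n)) = cube_le n"
  by (auto simp: phi_iff llp_def nabla_le)

lemma phi_cube_le: "phi n (cube_le n) = Id_on (cube n)"
  using phi_involution[OF Id_on_Tr] by (simp add: phi_Id_on)

lemma phi_1:
  assumes "R \<in> Tr (cube 1) (cube_le 1)"
  shows "phi 1 R = Phi 1 R"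
proof -
  have "Id_on (cube 1) \<subseteq> R" "R \<subseteq> cube_le 1"
    using assms unfolding Tr_cube_iff by (auto simp: cube_def)
  moreover have "cube_le 1 = insert ([False], [True]) (Id_on (cube 1))"
    by (auto simp: cube_le_1 cube_1)
  \<comment> \<open>Only one edge lies between the two bounds, so \<open>R\<close> is one of
    them.\<close>
  ultimately have "R = Id_on (cube 1) \<or> R = cube_le 1"
    by (metis insert_subset subset_antisym subset_insert)
  \<comment> \<open>The two systems differ, so the conditional in \<open>Phi\<close> takes its
    second branch on \<open>cube_le 1\<close>.\<close>
  moreover have "cube_le 1 \<noteq> Id_on (cube 1)"
  proof -
    have "([False], [True]) \<in> cube_le 1" "([False], [True]) \<notin> Id_on (cube 1)"
      by (auto simp: cube_le_1)
    then show ?thesis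
      by metis
  qed
  ultimately show ?thesis
    using Phi.simps(1)[folded One_nat_def, of R]
    by (elim disjE) (simp_all only: phi_Id_on phi_cube_le if_True if_False simp_thms)
qed

theorem theorem4p28:
  fixes n :: nat
  assumes "n \<ge> 1"
  shows "\<forall>R \<in> Tr (cube n) (cube_le n). phi n R = Phi n R"
  using assms
proof (induction n rule: nat_induct_at_least)
  case base
  then show ?case
    using phi_1 by blast
next
  case (Suc n)
  \<comment> \<open>The recursive clause of \<open>Phi\<close> applies from dimension 2 on.\<close>
  then obtain m where n: "n = Suc m"
    by (cases n) auto
  show ?case
  proof
    fix R
    assume R: "R \<in> Tr (cube (Suc n)) (cube_le (Suc n))"
    \<comment> \<open>The induction hypothesis covers transfer systems only, which the restrictions
      to facets are.\<close>
    have "Phi n (restrict_facet (Suc n) i b R) = phi n (restrict_facet (Suc n) i b R)"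
      if "i < Suc n" for i b
      using Suc.IH restrict_facet_Tr[OF R] that by simp
    then show "phi (Suc n) R = Phi (Suc n) R"
      using R by (simp add: n phi_Suc_Suc)
  qed
qed

end
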